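(* Let $N\ge1$ be an integer. The moment generating function of $\hat Z_N$ is \[ \psi_N(t)={\bf E}e^{t\hat Z_N}=\prod_{k=1}^{N}\left(\frac{1}{2^k}\,\frac{\sinh\left(\frac{t}{2\sigma_N}\,2^k\right)}{\sinh\left(\frac{t}{2\sigma_N}\right)}\right)=\prod_{1\le l\le k\le N}\cosh\left(2^{k-l}\,\frac{t}{2\sigma_N}\right),\qquad t\in\mathbb{R}. \] Its cumulant generating function is \[ \log\psi_N(t)=\sum_{k=1}^{N}\log\left(\frac{1}{2^k}\,\frac{\sinh\left(\frac{t}{2\sigma_N}\,2^k\right)}{\sinh\left(\frac{t}{2\sigma_N}\right)}\right). \] Moreover, denoting by $\kappa_j^{(N)}=\kappa_j(\hat Z_N)$ the $j$th order cumulant of $\hat Z_N$, $j=1,2,\ldots$, we have for all $n=1,2,\ldots$ \[ \kappa_{2n-1}^{(N)}=0,\qquad \kappa_{2n}^{(N)}=\frac{9^n}{4^n-1}\,\frac{4^n\left(4^{nN}-N-1\right)+N}{\left(4^N-\frac34 N-1\right)^n}\,\frac{B_{2n}}{2n}. \]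
   Context: For each integer $N\ge 1$, let $\Omega_N$ be the set of all $\omega=(k_1,\ldots,k_N)$ of integers with $0\le k_j\le 2^j-1$, $j=1,\ldots,N$, equipped with the uniform probability ${\bf P}(\omega)=2^{-N(N+1)/2}$, and let $Z_N(\omega)=k_1+\cdots+k_N$. Let $\mu_N={\bf E}Z_N=2^N-\frac N2-1$, $\sigma_N^2={\bf Var}\,Z_N=\frac19\left(2^{2N}-\frac34N-1\right)$ (with $\sigma_N>0$), and $\hat Z_N=(Z_N-\mu_N)/\sigma_N$. The cumulants $\kappa_j(\xi)$ of a random variable $\xi$ whose moment generating function is finite near $0$ are defined by $\log {\bf E}e^{t\xi}=\sum_{j\ge1}\kappa_j(\xi)\,t^j/j!$ for $t$ near $0$. The Bernoulli numbers $B_n$ are defined by $\sum_{n=0}^\infty B_n t^n/n!=t/(e^t-1)$. At $t=0$ the ratio $\sinh(2^k s)/\sinh(s)$ with $s=t/(2\sigma_N)$ is understood as its limit value $2^k$. *)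

theory Defs
  imports "HOL-Probability.Probability" "HOL-Computational_Algebra.Formal_Power_Series"
begin

definition Omega :: "nat \<Rightarrow> (nat \<Rightarrow> int) set" where
  "Omega N = (\<Pi>\<^sub>E j\<in>{1..N}. {0..2 ^ j - 1})"

definition unif :: "nat \<Rightarrow> (nat \<Rightarrow> int) measure" where
  "unif N = measure_pmf (pmf_of_set (Omega N))"

definition Z :: "nat \<Rightarrow> (nat \<Rightarrow> int) \<Rightarrow> real" where
  "Z N \<omega> = of_int (\<Sum>j=1..N. \<omega> j)"

definition mu :: "nat \<Rightarrow> real" where
  "mu N = (\<integral>\<omega>. Z N \<omega> \<partial>unif N)"

definition sigma :: "nat \<Rightarrow> real" where
  "sigma N = sqrt (\<integral>\<omega>. (Z N \<omega> - mu N)\<^sup>2 \<partial>unif N)"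

definition Zhat :: "nat \<Rightarrow> (nat \<Rightarrow> int) \<Rightarrow> real" where
  "Zhat N \<omega> = (Z N \<omega> - mu N) / sigma N"

definition mgf :: "'a measure \<Rightarrow> ('a \<Rightarrow> real) \<Rightarrow> real \<Rightarrow> real" where
  "mgf M X t = (\<integral>x. exp (t * X x) \<partial>M)"

text \<open>The power series of the logarithm of the moment generating function at 0. It is unspecified
  unless the moment generating function is finite near 0 (the Bochner integral in \<^const>\<open>mgf\<close> is 0
  for functions that are not integrable, hence the explicit integrability condition). When it
  exists, it is unique, and for a probability measure its constant term is 0.\<close>

definition cgf_series :: "'a measure \<Rightarrow> ('a \<Rightarrow> real) \<Rightarrow> real fps" where
  "cgf_series M X = (THE F. (\<forall>\<^sub>F t in nhds 0. integrable M (\<lambda>x. exp (t * X x))) \<and>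
     (\<lambda>t. ln (mgf M X t)) has_fps_expansion F)"

definition cumulant :: "'a measure \<Rightarrow> ('a \<Rightarrow> real) \<Rightarrow> nat \<Rightarrow> real" where
  "cumulant M X j = fact j * fps_nth (cgf_series M X) j"

definition bernoulli_number :: "nat \<Rightarrow> real" where
  "bernoulli_number n = fact n * fps_nth (fps_X / (fps_exp 1 - 1)) n"

text \<open>The ratio \<open>sinh (2\<^sup>k s) / sinh s\<close>, with its limit value \<open>2\<^sup>k\<close> at \<open>s = 0\<close>.\<close>

definition sinh_ratio :: "nat \<Rightarrow> real \<Rightarrow> real" where
  "sinh_ratio k s = (if s = 0 then 2 ^ k else sinh (2 ^ k * s) / sinh s)"

lemma finite_Omega: "finite (Omega N)"
  unfolding Omega_def by (intro finite_PiE) auto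

lemma Omega_nonempty: "Omega N \<noteq> {}"
  unfolding Omega_def by (auto simp: PiE_eq_empty_iff)

lemma card_Omega: "card (Omega N) = 2 ^ (N * (N + 1) div 2)"
proof -
  have "card (Omega N) = (\<Prod>j=1..N. 2 ^ j)"
    unfolding Omega_def by (subst card_PiE) (auto simp: nat_power_eq)
  also have "\<dots> = 2 ^ (\<Sum>j=1..N. j)"
    by (simp add: power_sum)
  also have "(\<Sum>j=1..N. j) = N * (N + 1) div 2"
    using gauss_sum_nat[of N] by (simp add: atLeast0AtMost atLeast1_atMost_eq_remove0 sum_diff1_nat)
  finally show ?thesis .
qed

lemma pmf_Omega:
  assumes "\<omega> \<in> Omega N"
  shows "measure (unif N) {\<omega>} = 2 powr (- (real N * (real N + 1) / 2))"
proof -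
  have eq: "real (N * (N + 1) div 2) = real N * (real N + 1) / 2"
    by (subst real_of_nat_div) (auto simp: algebra_simps)
  have "measure (unif N) {\<omega>} = 1 / 2 ^ (N * (N + 1) div 2)"
    using assms finite_Omega[of N] Omega_nonempty[of N]
    by (simp add: unif_def measure_pmf_single card_Omega)
  also have "\<dots> = 1 / 2 powr (real N * (real N + 1) / 2)"
    by (simp only: eq[symmetric] powr_realpow zero_less_numeral)
  finally show ?thesis
    by (simp add: powr_minus_divide)
qed

lemma integrable_unif [simp]: "integrable (unif N) (f :: _ \<Rightarrow> real)"
  unfolding unif_def by (rule integrable_measure_pmf_finite) (simp add: finite_Omega Omega_nonempty)

lemma has_fps_expansion_unique_real:
  fixes F G :: "real fps"
  assumes "f has_fps_expansion F" "f has_fps_expansion G"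
  shows "F = G"
proof (rule ccontr)
  assume "F \<noteq> G"
  define H where "H = F - G"
  define n where "n = subdegree H"
  have "H \<noteq> 0"
    using \<open>F \<noteq> G\<close> by (simp add: H_def)
  have "(\<lambda>x. 0) has_fps_expansion H"
    using has_fps_expansion_diff[OF assms] by (simp add: H_def)
  then have *: "(\<lambda>x. if x = 0 then fps_nth H n else 0 / x ^ n) has_fps_expansion fps_shift n H"
    by (rule has_fps_expansion_shift) (simp_all add: n_def)
  have "((\<lambda>x. if x = 0 then fps_nth H n else 0 / x ^ n) \<longlongrightarrow> fps_nth H n) (at 0)"
    using has_fps_expansion_imp_continuous[OF *, of UNIV] by (simp add: continuous_at)
  moreover have "((\<lambda>x::real. if x = 0 then fps_nth H n else 0 / x ^ n) \<longlongrightarrow> 0) (at 0)"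
    by (rule tendsto_eventually) (auto simp: eventually_at intro!: exI[of _ 1])
  ultimately have "fps_nth H n = 0"
    by (rule tendsto_unique[rotated]) simp
  then show False
    using \<open>H \<noteq> 0\<close> by (simp add: n_def)
qed

lemma cgf_seriesI:
  assumes "\<forall>\<^sub>F t in nhds 0. integrable M (\<lambda>x. exp (t * X x))"
    and "(\<lambda>t. ln (mgf M X t)) has_fps_expansion F"
  shows "cgf_series M X = F"
  unfolding cgf_series_def
proof (rule the_equality)
  fix G assume "(\<forall>\<^sub>F t in nhds 0. integrable M (\<lambda>x. exp (t * X x))) \<and>
    (\<lambda>t. ln (mgf M X t)) has_fps_expansion G"
  then show "G = F"
    using assms(2) has_fps_expansion_unique_real by blast
qed (use assms in simp)

lemma bernoulli_number_series:
  "Abs_fps (\<lambda>n. bernoulli_number n / fact n) * (fps_exp 1 - 1) = fps_X"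
proof -
  have nz: "fps_exp 1 - (1 :: real fps) \<noteq> 0"
    by (auto simp: fps_eq_iff intro!: exI[of _ 1])
  have "subdegree (fps_exp 1 - (1 :: real fps)) = 1"
    by (rule subdegreeI) auto
  then have "fps_exp 1 - (1 :: real fps) dvd fps_X"
    using nz by (subst fps_dvd_iff) auto
  then have "fps_X / (fps_exp 1 - 1) * (fps_exp 1 - 1 :: real fps) = fps_X"
    by simp
  moreover have "Abs_fps (\<lambda>n. bernoulli_number n / fact n) = fps_X / (fps_exp 1 - 1)"
    by (rule fps_ext) (simp add: bernoulli_number_def)
  ultimately show ?thesis by simp
qed

end

theory Submission
  imports Defs
begin

text \<open>
  Everything is governed by the function \<open>q u = (exp u - 1) / u\<close>, the
  moment generating function of the uniform distribution on the unit interval. A uniform variable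
  on \<open>{0..2\<^sup>k - 1}\<close> has the moment generating function \<open>q (2\<^sup>k u) / q u\<close>, by the geometric series, and
  under the uniform distribution on the product set the coordinates are independent, so \<open>Z\<close> has
  the product of these quotients (\<open>mgf_Z\<close>). Since \<open>q u\<close> is \<open>exp (u / 2)\<close> times an even function,
  namely \<open>sinh (u / 2) / (u / 2)\<close>, each quotient is a ratio of hyperbolic sines up to an
  exponential factor; the exponential factors multiply to \<open>exp (mu u)\<close>, which centring removes. The
  product of hyperbolic cosines is the doubling formula for \<open>sinh\<close>, iterated.

  For the cumulants, \<open>u q'(u) / q u = u / (exp u - 1) + u - 1\<close>, and the first summand on the right
  generates the Bernoulli numbers. Integrating term by term gives the series of \<open>ln q\<close>: its \<open>n\<close>-th
  coefficient is \<open>(-1)\<^sup>n B\<^sub>n / (n n!)\<close> for \<open>n \<ge> 1\<close>. Rescaling the argument by \<open>2\<^sup>k\<close> multiplies this by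
  \<open>(2\<^sup>k)\<^sup>n\<close>, so the \<open>n\<close>-th cumulant of \<open>Z\<close> is \<open>(-1)\<^sup>n B\<^sub>n / n\<close> times the sum of \<open>(2\<^sup>n)\<^sup>k - 1\<close> over \<open>k\<close>
  (\<open>cumulant_Z\<close>).

  Mean and variance are the first two cumulants, so \<open>mu\<close> and \<open>sigma\<close> are read off from this formula
  with \<open>B\<^sub>1 = -1/2\<close> and \<open>B\<^sub>2 = 1/6\<close>. Finally, standardising a variable divides the \<open>n\<close>-th
  cumulant by \<open>sigma\<^sup>n\<close> and changes no cumulant beyond the first in any other way
  (\<open>cumulant_affine\<close>); the odd ones vanish because \<open>B\<^sub>n = 0\<close> for odd \<open>n \<ge> 3\<close>.
\<close>

section \<open>Power series of logarithms\<close>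

text \<open>Integration divides the \<open>n\<close>-th coefficient by \<open>n + 1\<close>, so up to a factor \<open>r\<close> the terms at \<open>r\<close> of
  the original series dominate.\<close>

lemma fps_conv_radius_integral_ge:
  fixes G :: "real fps"
  shows "fps_conv_radius (fps_integral G a) \<ge> fps_conv_radius G"
  unfolding fps_conv_radius_def
proof (rule conv_radius_geI_ex')
  fix r :: real
  assume r: "0 < r" "ereal r < conv_radius (fps_nth G)"
  have "summable (\<lambda>n. r * norm (fps_nth G n * r ^ n))"
    using r abs_summable_in_conv_radius[of r "fps_nth G"] by (intro summable_mult) simp
  moreover have "norm (fps_nth (fps_integral G a) (Suc n) * r ^ Suc n) \<le> r * norm (fps_nth G n * r ^ n)" for n
  proof -
    have "norm (fps_nth (fps_integral G a) (Suc n) * r ^ Suc n) =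
        inverse (real (Suc n)) * (r * norm (fps_nth G n * r ^ n))"
      unfolding fps_integral_nth_0_Suc power_Suc norm_mult using r(1) by simp
    also have "\<dots> \<le> 1 * (r * norm (fps_nth G n * r ^ n))"
      using r(1) by (intro mult_right_mono) (auto simp: field_simps)
    finally show ?thesis by simp
  qed
  ultimately have "summable (\<lambda>n. fps_nth (fps_integral G a) (Suc n) * r ^ Suc n)"
    by (rule summable_comparison_test'[where N = 0])
  then show "summable (\<lambda>n. fps_nth (fps_integral G a) n * of_real r ^ n)"
    using summable_Suc_iff[of "\<lambda>n. fps_nth (fps_integral G a) n * r ^ n"] by simp
qed

text \<open>The value of an expandable function and of its series agree at 0, and near 0 the two have the
  same derivative.\<close>

lemma has_fps_expansion_antiderivative:
  fixes g h :: "real \<Rightarrow> real"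
  assumes g: "g has_fps_expansion G"
    and h: "\<forall>\<^sub>F t in nhds 0. (h has_field_derivative g t) (at t)"
  shows "h has_fps_expansion fps_integral G (h 0)"
proof -
  define H where "H = fps_integral G (h 0)"
  have deriv_H: "fps_deriv H = G"
    by (simp add: H_def fps_deriv_fps_integral)
  have "fps_conv_radius G \<le> fps_conv_radius H"
    unfolding H_def by (rule fps_conv_radius_integral_ge)
  then have radius: "fps_conv_radius H > 0"
    using g by (auto simp: has_fps_expansion_def)
  have "\<forall>\<^sub>F t in nhds 0. t \<in> eball 0 (fps_conv_radius H) \<and> eval_fps G t = g t \<and>
      (h has_field_derivative g t) (at t)"
    using radius g h
    by (intro eventually_conj eventually_nhds_in_open)
       (auto simp: has_fps_expansion_def zero_ereal_def)
  then obtain e where e: "e > 0" "\<And>t. dist t 0 < e \<Longrightarrow> t \<in> eball 0 (fps_conv_radius H) \<and>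
      eval_fps G t = g t \<and> (h has_field_derivative g t) (at t)"
    unfolding eventually_nhds_metric by blast
  have const: "((\<lambda>t. h t - eval_fps H t) has_field_derivative 0) (at t within ball 0 e)"
    if "t \<in> ball 0 e" for t
  proof -
    have t: "ereal (norm t) < fps_conv_radius H" "eval_fps G t = g t"
        "(h has_field_derivative g t) (at t)"
      using that e(2)[of t] by (simp_all add: dist_commute in_eball_iff)
    have dh: "(h has_field_derivative g t) (at t within ball 0 e)"
      using t(3) by (rule has_field_derivative_at_within)
    have dH: "(eval_fps H has_field_derivative g t) (at t within ball 0 e)"
      using has_field_derivative_eval_fps[OF t(1), of "ball 0 e"] by (simp add: deriv_H t(2))
    show ?thesis
      using DERIV_diff[OF dh dH] by simp
  qed
  then obtain c where c: "\<And>t. t \<in> ball 0 e \<Longrightarrow> h t - eval_fps H t = c"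
    using const has_field_derivative_zero_constant[OF convex_ball, of 0 e "\<lambda>t. h t - eval_fps H t"] by blast
  have "c = 0"
    using c[of 0] e(1) by (simp add: H_def eval_fps_at_0)
  then have "\<forall>\<^sub>F t in nhds 0. eval_fps H t = h t"
    unfolding eventually_nhds_metric using c e(1) by (auto simp: dist_commute intro!: exI[of _ e])
  with radius show ?thesis
    by (simp add: has_fps_expansion_def H_def)
qed

lemma has_fps_expansion_nth_0:
  "f has_fps_expansion F \<Longrightarrow> fps_nth F 0 = f 0"
  by (auto simp: has_fps_expansion_def eval_fps_at_0 dest: eventually_nhds_x_imp_x)

text \<open>Working with the logarithmic derivative \<open>F' / F\<close> avoids composing with the series of \<open>ln (1 + x)\<close>
  and makes the coefficients computable: they solve the linear equation \<open>L' F = F'\<close>.\<close>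

lemma has_fps_expansion_ln:
  fixes f :: "real \<Rightarrow> real"
  assumes f: "f has_fps_expansion F" and pos: "f 0 > 0"
  shows "(\<lambda>t. ln (f t)) has_fps_expansion fps_integral (fps_deriv F / F) (ln (f 0))"
proof (rule has_fps_expansion_antiderivative)
  show "(\<lambda>t. deriv f t / f t) has_fps_expansion fps_deriv F / F"
    using f pos by (intro has_fps_expansion_divide' has_fps_expansion_deriv)
      (auto simp: has_fps_expansion_nth_0)
  from f have "\<forall>\<^sub>F t in nhds 0. t \<in> eball 0 (fps_conv_radius F)"
    by (intro eventually_nhds_in_open) (auto simp: has_fps_expansion_def zero_ereal_def)
  moreover from f have "\<forall>\<^sub>F t in nhds 0. \<forall>\<^sub>F u in nhds t. eval_fps F u = f u"
    by (simp add: has_fps_expansion_def eventually_eventually)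
  moreover have "\<forall>\<^sub>F t in nhds 0. f t > 0"
  proof -
    have "(f \<longlongrightarrow> f 0) (nhds 0)"
      using has_fps_expansion_imp_continuous[OF f, of UNIV]
      by (simp add: continuous_at tendsto_nhds_iff)
    then show ?thesis using pos by (rule order_tendstoD)
  qed
  ultimately show "\<forall>\<^sub>F t in nhds 0. ((\<lambda>t. ln (f t)) has_field_derivative deriv f t / f t) (at t)"
  proof eventually_elim
    case (elim t)
    have "(eval_fps F has_field_derivative eval_fps (fps_deriv F) t) (at t)"
      using elim by (intro has_field_derivative_eval_fps) (auto simp: in_eball_iff)
    then have deriv: "(f has_field_derivative eval_fps (fps_deriv F) t) (at t)"
      using DERIV_cong_ev[OF refl elim(2) refl] by blast
    show ?case
      using DERIV_chain2[OF DERIV_ln_divide[OF elim(3)] deriv] DERIV_imp_deriv[OF deriv]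
      by simp
  qed
qed

lemma has_fps_expansion_scale:
  fixes f :: "real \<Rightarrow> real"
  assumes "f has_fps_expansion F"
  shows "(\<lambda>t. f (c * t)) has_fps_expansion Abs_fps (\<lambda>n. c ^ n * fps_nth F n)"
proof (rule has_fps_expansionI)
  have "\<forall>\<^sub>F u in nhds 0. u \<in> eball 0 (fps_conv_radius F)"
    using assms by (intro eventually_nhds_in_open) (auto simp: has_fps_expansion_def zero_ereal_def)
  moreover have "\<forall>\<^sub>F u in nhds 0. eval_fps F u = f u"
    using assms by (simp add: has_fps_expansion_def)
  ultimately have "\<forall>\<^sub>F u in nhds 0. (\<lambda>n. fps_nth F n * u ^ n) sums f u"
  proof eventually_elim
    case (elim u)
    then show ?case
      using sums_eval_fps[of u F] by (simp add: in_eball_iff)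
  qed
  moreover have "filterlim (\<lambda>t. c * t) (nhds 0) (nhds 0)"
    using tendsto_mult_right_zero[OF filterlim_ident, of c] by simp
  ultimately have "\<forall>\<^sub>F t in nhds 0. (\<lambda>n. fps_nth F n * (c * t) ^ n) sums f (c * t)"
    by (rule eventually_compose_filterlim)
  then show "\<forall>\<^sub>F t in nhds 0. (\<lambda>n. fps_nth (Abs_fps (\<lambda>n. c ^ n * fps_nth F n)) n * t ^ n) sums f (c * t)"
    by (simp add: power_mult_distrib mult_ac)
qed

section \<open>Cumulants of finitely supported distributions\<close>

lemma mgf_has_fps_expansion_moments:
  assumes fin: "finite (set_pmf p)"
  shows "mgf (measure_pmf p) X has_fps_expansion
    Abs_fps (\<lambda>n. (\<integral>x. X x ^ n \<partial>measure_pmf p) / fact n)"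
proof (rule has_fps_expansion_schematicI)
  have mgf_eq: "mgf (measure_pmf p) X = (\<lambda>t. \<Sum>a\<in>set_pmf p. pmf p a * exp (X a * t))"
    using fin by (auto simp: mgf_def fun_eq_iff mult.commute integral_measure_pmf_real[where A = "set_pmf p"])
  show "mgf (measure_pmf p) X has_fps_expansion
    (\<Sum>a\<in>set_pmf p. fps_const (pmf p a) * fps_exp (X a))"
    unfolding mgf_eq by (intro fps_expansion_intros)
  show "(\<Sum>a\<in>set_pmf p. fps_const (pmf p a) * fps_exp (X a)) =
    Abs_fps (\<lambda>n. (\<integral>x. X x ^ n \<partial>measure_pmf p) / fact n)"
    using fin
    by (simp add: fps_eq_iff fps_sum_nth integral_measure_pmf_real[where A = "set_pmf p"]
        sum_divide_distrib mult.commute)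
qed

lemma mgf_pmf_0: "mgf (measure_pmf p) X 0 = 1"
  by (simp add: mgf_def)

lemma
  fixes X :: "'a \<Rightarrow> real"
  assumes fin: "finite (set_pmf p)"
  defines "M \<equiv> Abs_fps (\<lambda>n. (\<integral>x. X x ^ n \<partial>measure_pmf p) / fact n)"
  shows cgf_series_pmf: "cgf_series (measure_pmf p) X = fps_integral (fps_deriv M / M) 0"
    and ln_mgf_has_fps_expansion:
      "(\<lambda>t. ln (mgf (measure_pmf p) X t)) has_fps_expansion cgf_series (measure_pmf p) X"
proof -
  have exp: "(\<lambda>t. ln (mgf (measure_pmf p) X t)) has_fps_expansion fps_integral (fps_deriv M / M) 0"
    using has_fps_expansion_ln[OF mgf_has_fps_expansion_moments[OF fin, of X]]
    unfolding M_def mgf_pmf_0 ln_one by (metis zero_less_one)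
  then show *: "cgf_series (measure_pmf p) X = fps_integral (fps_deriv M / M) 0"
    by (intro cgf_seriesI always_eventually allI integrable_measure_pmf_finite fin)
  show "(\<lambda>t. ln (mgf (measure_pmf p) X t)) has_fps_expansion cgf_series (measure_pmf p) X"
    using exp by (simp add: *)
qed

text \<open>With \<open>C\<close> the cumulant and \<open>M\<close> the moment series, comparing the coefficients of orders 0 and 1 in
  \<open>C' M = M'\<close> gives the first two cumulants. They allow the mean and the variance to be read off
  from a moment generating function.\<close>

lemma
  assumes fin: "finite (set_pmf p)"
  shows cumulant_1: "cumulant (measure_pmf p) X 1 = (\<integral>x. X x \<partial>measure_pmf p)"
    and cumulant_2: "cumulant (measure_pmf p) X 2 =
      (\<integral>x. (X x - (\<integral>y. X y \<partial>measure_pmf p))\<^sup>2 \<partial>measure_pmf p)"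
proof -
  define m where "m = (\<lambda>n. \<integral>x. X x ^ n \<partial>measure_pmf p)"
  define M where "M = Abs_fps (\<lambda>n. m n / fact n)"
  define C where "C = cgf_series (measure_pmf p) X"
  have m0: "m 0 = 1"
    by (simp add: m_def)
  have "fps_deriv C = fps_deriv M / M"
    unfolding C_def M_def m_def by (simp add: cgf_series_pmf[OF fin] fps_deriv_fps_integral)
  then have log_deriv: "fps_deriv C * M = fps_deriv M"
    using m0 by (simp add: M_def)
  have C1: "fps_nth C 1 = m 1"
    using arg_cong[OF log_deriv, of "\<lambda>F. fps_nth F 0"] by (simp add: M_def m0)
  have C2: "2 * fps_nth C 2 = m 2 - (m 1)\<^sup>2"
    using arg_cong[OF log_deriv, of "\<lambda>F. fps_nth F 1"] C1
    by (simp add: M_def m0 fps_mult_nth numeral_2_eq_2 power2_eq_square)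
  show "cumulant (measure_pmf p) X 1 = (\<integral>x. X x \<partial>measure_pmf p)"
    using C1 by (simp add: cumulant_def C_def m_def)
  have "m 2 - (m 1)\<^sup>2 = (\<integral>x. (X x - (\<integral>y. X y \<partial>measure_pmf p))\<^sup>2 \<partial>measure_pmf p)"
    unfolding m_def using fin measure_pmf.variance_eq[of p X]
    by (simp add: integrable_measure_pmf_finite)
  then show "cumulant (measure_pmf p) X 2 =
      (\<integral>x. (X x - (\<integral>y. X y \<partial>measure_pmf p))\<^sup>2 \<partial>measure_pmf p)"
    using C2 by (simp add: cumulant_def C_def)
qed

lemma mgf_affine:
  "mgf M (\<lambda>x. (X x - a) / s) t = exp (- (a / s * t)) * mgf M X (t / s)"
proof -
  have "exp (t * ((X x - a) / s)) = exp (- (a / s * t)) * exp (t / s * X x)" for x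
    by (simp add: diff_divide_distrib algebra_simps flip: exp_add)
  then show ?thesis
    by (simp add: mgf_def)
qed

text \<open>On the side of the cumulant series, scaling rescales the argument and a shift adds a linear
  term, so the shift is felt by the first cumulant only. For \<open>s = 0\<close> the
  variable is constantly 0 by the convention for division, and the formula still holds.\<close>

lemma cumulant_affine:
  assumes fin: "finite (set_pmf p)"
  shows "cumulant (measure_pmf p) (\<lambda>x. (X x - a) / s) n =
    (cumulant (measure_pmf p) X n - (if n = 1 then a else 0)) / s ^ n"
proof -
  define C where "C = cgf_series (measure_pmf p) X"
  have pos: "mgf (measure_pmf p) X t > 0" for t
  proof -
    have "(\<integral>x. exp (t * X x) \<partial>measure_pmf p) = (\<Sum>x\<in>set_pmf p. exp (t * X x) * pmf p x)"
      using fin by (intro integral_measure_pmf_real) auto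
    also have "\<dots> > 0"
      using fin by (intro sum_pos) (auto simp: set_pmf_not_empty pmf_positive)
    finally show ?thesis by (simp add: mgf_def)
  qed
  have "(\<lambda>t. ln (mgf (measure_pmf p) X (1 / s * t)) - a / s * t) has_fps_expansion
      Abs_fps (\<lambda>n. (1 / s) ^ n * fps_nth C n) - fps_const (a / s) * fps_X"
    unfolding C_def
    by (intro fps_expansion_intros has_fps_expansion_scale ln_mgf_has_fps_expansion[OF fin])
  also have "(\<lambda>t. ln (mgf (measure_pmf p) X (1 / s * t)) - a / s * t) =
      (\<lambda>t. ln (mgf (measure_pmf p) (\<lambda>x. (X x - a) / s) t))"
    by (simp add: fun_eq_iff mgf_affine ln_mult less_imp_neq[OF pos, symmetric])
  finally have "cgf_series (measure_pmf p) (\<lambda>x. (X x - a) / s) =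
      Abs_fps (\<lambda>n. (1 / s) ^ n * fps_nth C n) - fps_const (a / s) * fps_X"
    by (intro cgf_seriesI always_eventually allI integrable_measure_pmf_finite fin)
  then show ?thesis
    by (simp add: cumulant_def C_def power_divide diff_divide_distrib)
qed

section \<open>Bernoulli numbers and the logarithm of \<open>(exp u - 1) / u\<close>\<close>

definition bernoulli_fps :: "real fps" where
  "bernoulli_fps = Abs_fps (\<lambda>n. bernoulli_number n / fact n)"

lemma bernoulli_fps_mult_expm1: "bernoulli_fps * (fps_exp 1 - 1) = fps_X"
  unfolding bernoulli_fps_def by (rule bernoulli_number_series)

text \<open>The series of \<open>(exp u - 1) / u\<close>.\<close>

definition expm1_ratio_fps :: "real fps" where
  "expm1_ratio_fps = Abs_fps (\<lambda>n. 1 / fact (Suc n))"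

lemma fps_X_mult_expm1_ratio_fps: "fps_X * expm1_ratio_fps = fps_exp 1 - 1"
proof (rule fps_ext)
  fix n
  show "fps_nth (fps_X * expm1_ratio_fps) n = fps_nth (fps_exp 1 - 1) n"
    by (cases n) (simp_all add: expm1_ratio_fps_def del: fact_Suc)
qed

lemma bernoulli_fps_mult_expm1_ratio_fps: "bernoulli_fps * expm1_ratio_fps = 1"
proof -
  have "fps_X * (bernoulli_fps * expm1_ratio_fps) = fps_X * 1"
    by (simp only: mult.left_commute[of fps_X] fps_X_mult_expm1_ratio_fps
        bernoulli_fps_mult_expm1 mult_1_right)
  then show ?thesis by simp
qed

lemma bernoulli_number_0_1_2:
  "bernoulli_number 0 = 1" "bernoulli_number 1 = -1/2" "bernoulli_number 2 = 1/6"
proof -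
  have *: "(\<Sum>i\<le>n. bernoulli_number i / fact i * (1 / fact (Suc (n - i)))) = (if n = 0 then 1 else 0)" for n
    using arg_cong[OF bernoulli_fps_mult_expm1_ratio_fps, of "\<lambda>F. fps_nth F n"]
    by (simp add: fps_mult_nth bernoulli_fps_def expm1_ratio_fps_def atLeast0AtMost del: fact_Suc)
  show 0: "bernoulli_number 0 = 1" using *[of 0] by simp
  show 1: "bernoulli_number 1 = -1/2" using *[of 1] 0 by simp
  show "bernoulli_number 2 = 1/6" using *[of 2] 0 1
    by (simp add: numeral_2_eq_2 fact_numeral)
qed

text \<open>This is the identity \<open>- u / (exp (- u) - 1) = u / (exp u - 1) + u\<close>. It makes all odd
  Bernoulli numbers beyond the first vanish, so that the sign \<open>(-1)\<^sup>n\<close> changes \<open>B\<^sub>1\<close> only, from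
  \<open>-1/2\<close> to \<open>1/2\<close>.\<close>

lemma bernoulli_fps_reflect: "bernoulli_fps oo (fps_const (- 1) * fps_X) = bernoulli_fps + fps_X"
proof -
  define R where "R = bernoulli_fps oo (fps_const (- 1) * fps_X)"
  have nz: "fps_exp 1 - (1 :: real fps) \<noteq> 0"
    by (auto simp: fps_eq_iff intro!: exI[of _ 1])
  have "R * (fps_exp (- 1) - 1) = fps_X oo (fps_const (- 1) * fps_X)"
    using arg_cong[OF bernoulli_fps_mult_expm1, of "\<lambda>F. F oo (fps_const (- 1) * fps_X)"]
    by (simp add: R_def fps_compose_mult_distrib fps_compose_sub_distrib fps_exp_compose_linear)
  moreover have "fps_const (- 1) * fps_X = (- fps_X :: real fps)"
    by (simp flip: fps_const_neg)
  ultimately have "R * (fps_exp (- 1) - 1) = - fps_X"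
    by simp
  moreover have "fps_exp 1 * fps_exp (- 1) = (1 :: real fps)"
    by (simp flip: fps_exp_add_mult)
  ultimately have "R * (fps_exp 1 - 1) = (bernoulli_fps + fps_X) * (fps_exp 1 - 1)"
    using bernoulli_fps_mult_expm1 by algebra
  then show ?thesis
    using nz by (simp add: R_def)
qed

lemma bernoulli_number_reflect:
  "(- 1) ^ n * bernoulli_number n = bernoulli_number n + (if n = 1 then 1 else 0)"
proof -
  have "(- 1) ^ n * (bernoulli_number n / fact n) =
      bernoulli_number n / fact n + (if n = 1 then 1 else 0)"
    using arg_cong[OF bernoulli_fps_reflect, of "\<lambda>F. fps_nth F n"]
    unfolding fps_nth_compose_linear by (simp add: bernoulli_fps_def)
  then show ?thesis
    by (auto simp: field_simps split: if_splits)
qed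

lemma bernoulli_number_odd:
  assumes "odd n" "n \<noteq> 1"
  shows "bernoulli_number n = 0"
  using bernoulli_number_reflect[of n] assms by simp

text \<open>The moment generating function of the uniform distribution on the unit interval, and the
  reciprocal of the generating function of the Bernoulli numbers. The value at 0 is the limit.\<close>

definition expm1_ratio :: "real \<Rightarrow> real" where
  "expm1_ratio u = (if u = 0 then 1 else (exp u - 1) / u)"

lemma expm1_ratio_pos: "expm1_ratio u > 0"
  by (auto simp: expm1_ratio_def zero_less_divide_iff)

lemma expm1_ratio_has_fps_expansion:
  "expm1_ratio has_fps_expansion expm1_ratio_fps"
proof -
  have "(\<lambda>u::real. exp u - 1) has_fps_expansion fps_exp 1 - 1"
    by (intro fps_expansion_intros)
  moreover have "1 \<le> subdegree (fps_exp 1 - (1 :: real fps))"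
    by (intro subdegree_geI) (auto simp: fps_eq_iff intro!: exI[of _ 1])
  ultimately have "(\<lambda>u. if u = 0 then 1 else (exp u - 1) / u ^ 1) has_fps_expansion
      fps_shift 1 (fps_exp 1 - (1 :: real fps))"
    by (rule has_fps_expansion_shift) simp
  also have "fps_shift 1 (fps_exp 1 - (1 :: real fps)) = expm1_ratio_fps"
    by (simp add: fps_eq_iff expm1_ratio_fps_def del: fact_Suc)
  also have "(\<lambda>u. if u = 0 then 1 else (exp u - 1) / u ^ 1) = expm1_ratio"
    by (simp add: fun_eq_iff expm1_ratio_def)
  finally show ?thesis .
qed

text \<open>Differentiating \<open>u q u = exp u - 1\<close> and dividing by \<open>q u\<close> gives
  \<open>u q'(u) / q u = u / (exp u - 1) + u - 1\<close>. The summand \<open>u\<close> turns \<open>B\<^sub>1\<close> into \<open>B\<^sub>1 + 1 = - B\<^sub>1\<close>, which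
  the sign \<open>(-1)\<^sup>n\<close> expresses uniformly, as the other odd Bernoulli numbers are 0.\<close>

lemma ln_expm1_ratio_has_fps_expansion:
  "(\<lambda>u. ln (expm1_ratio u)) has_fps_expansion
    Abs_fps (\<lambda>n. if n = 0 then 0 else (- 1) ^ n * bernoulli_number n / (real n * fact n))"
proof -
  define Q where "Q = expm1_ratio_fps"
  define D where "D = fps_shift 1 (bernoulli_fps + fps_X - 1)"
  have XQ: "fps_X * Q = fps_exp 1 - 1"
    unfolding Q_def by (rule fps_X_mult_expm1_ratio_fps)
  have XD: "fps_X * D = bernoulli_fps + fps_X - 1"
  proof (rule fps_ext)
    fix n
    show "fps_nth (fps_X * D) n = fps_nth (bernoulli_fps + fps_X - 1) n"
      by (cases n) (simp_all add: D_def bernoulli_fps_def bernoulli_number_0_1_2)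
  qed
  have BQ: "bernoulli_fps * Q = 1"
    unfolding Q_def by (rule bernoulli_fps_mult_expm1_ratio_fps)
  have "Q + fps_X * fps_deriv Q = fps_exp 1"
    using arg_cong[OF XQ, of fps_deriv] by (simp add: add.commute)
  then have XQ': "fps_X * fps_deriv Q = fps_exp 1 - Q"
    by (simp add: algebra_simps)
  have "fps_X * (D * Q) = (bernoulli_fps + fps_X - 1) * Q"
    by (simp only: XD mult.assoc[symmetric])
  also have "\<dots> = fps_X * fps_deriv Q"
    by (simp only: ring_distribs BQ XQ XQ') simp
  finally have "fps_X * (D * Q) = fps_X * fps_deriv Q" .
  then have "fps_deriv Q = D * Q" by simp
  moreover have "Q \<noteq> 0" using BQ by auto
  ultimately have "fps_deriv Q / Q = D" by simp
  then have "(\<lambda>u. ln (expm1_ratio u)) has_fps_expansion fps_integral D 0"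
    using has_fps_expansion_ln[OF expm1_ratio_has_fps_expansion expm1_ratio_pos]
    by (simp add: Q_def expm1_ratio_def)
  also have "fps_integral D 0 =
    Abs_fps (\<lambda>n. if n = 0 then 0 else (- 1) ^ n * bernoulli_number n / (real n * fact n))"
  proof (rule fps_ext)
    fix n
    show "fps_nth (fps_integral D 0) n = fps_nth (Abs_fps (\<lambda>n. if n = 0 then 0 else
        (- 1) ^ n * bernoulli_number n / (real n * fact n))) n"
    proof (cases n)
      case (Suc k)
      then show ?thesis
        unfolding bernoulli_number_reflect
        by (simp add: D_def bernoulli_fps_def field_simps del: of_nat_Suc fact_Suc)
    qed simp
  qed
  finally show ?thesis .
qed

section \<open>The moment generating function and the cumulants of the sum\<close>

lemma expm1_ratio_eq_sinh:
  "u \<noteq> 0 \<Longrightarrow> expm1_ratio u = exp (u / 2) * (sinh (u / 2) / (u / 2))"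
  by (simp add: expm1_ratio_def sinh_def field_simps flip: exp_add)

text \<open>The left-hand side is the moment generating function of a uniform variable on
  \<open>{0..2\<^sup>k - 1}\<close>. In the quotient of \<open>(exp (2\<^sup>k u) - 1) / (2\<^sup>k u)\<close> and \<open>(exp u - 1) / u\<close> the arguments
  in the denominators leave just the normalising factor \<open>1 / 2\<^sup>k\<close>.\<close>

lemma mean_exp_eq_expm1_ratio_quotient:
  "(\<Sum>i\<in>{0..2 ^ k - 1 :: int}. exp (u * of_int i)) / 2 ^ k = expm1_ratio (2 ^ k * u) / expm1_ratio u"
proof -
  have "(\<Sum>i\<in>{0..2 ^ k - 1 :: int}. exp (u * of_int i)) = (\<Sum>i<2 ^ k. exp (u * real i))"
    by (rule sum.reindex_bij_witness[of _ int nat])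
      (auto simp: nat_less_iff nat_power_eq of_nat_less_iff simp flip: of_nat_power)
  also have "\<dots> = (\<Sum>i<2 ^ k. exp u ^ i)"
    by (simp add: exp_of_nat_mult[symmetric] mult.commute)
  finally have sum: "(\<Sum>i\<in>{0..2 ^ k - 1 :: int}. exp (u * of_int i)) = (\<Sum>i<2 ^ k. exp u ^ i)" .
  show ?thesis
  proof (cases "u = 0")
    case False
    then have geometric: "(\<Sum>i<2 ^ k. exp u ^ i) = (exp (2 ^ k * u) - 1) / (exp u - 1)"
      using exp_of_nat_mult[of "2 ^ k" u] by (subst geometric_sum) auto
    with False show ?thesis
      by (simp add: sum geometric expm1_ratio_def)
  qed (simp add: sum expm1_ratio_def)
qed

lemma expm1_ratio_quotient_eq_sinh_ratio:
  "expm1_ratio (2 ^ k * u) / expm1_ratio u =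
    exp ((2 ^ k - 1) * u / 2) * (1 / 2 ^ k * sinh_ratio k (u / 2))"
proof (cases "u = 0")
  case False
  then show ?thesis
    by (simp add: expm1_ratio_eq_sinh sinh_ratio_def field_simps flip: exp_add)
qed (simp add: expm1_ratio_def sinh_ratio_def)

text \<open>Independence of the coordinates is the distributive law: a sum over the product set of a product
  over the coordinates is the product of the coordinatewise sums.\<close>

lemma mgf_Z: "mgf (unif N) (Z N) u = (\<Prod>k=1..N. expm1_ratio (2 ^ k * u) / expm1_ratio u)"
proof -
  have card: "real (card (Omega N)) = (\<Prod>j=1..N. 2 ^ j)"
    unfolding Omega_def by (subst card_PiE) (auto simp: nat_power_eq)
  have "mgf (unif N) (Z N) u = (\<Sum>\<omega>\<in>Omega N. exp (u * Z N \<omega>)) / real (card (Omega N))"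
    unfolding mgf_def unif_def by (rule integral_pmf_of_set) (simp_all add: finite_Omega Omega_nonempty)
  also have "(\<Sum>\<omega>\<in>Omega N. exp (u * Z N \<omega>)) =
      (\<Sum>\<omega>\<in>Omega N. \<Prod>j=1..N. exp (u * of_int (\<omega> j)))"
    by (simp add: Z_def exp_sum sum_distrib_left)
  also have "\<dots> = (\<Prod>j=1..N. \<Sum>i\<in>{0..2 ^ j - 1}. exp (u * of_int i))"
    unfolding Omega_def by (rule prod_sum_PiE[symmetric]) auto
  also have "\<dots> / real (card (Omega N)) =
      (\<Prod>j=1..N. (\<Sum>i\<in>{0..2 ^ j - 1}. exp (u * of_int i)) / 2 ^ j)"
    by (simp add: card prod_dividef)
  finally show ?thesis
    by (simp add: mean_exp_eq_expm1_ratio_quotient)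
qed

lemma finite_set_pmf_of_set_Omega: "finite (set_pmf (pmf_of_set (Omega N)))"
  by (simp add: finite_Omega Omega_nonempty)

lemma cumulant_Z:
  assumes "n \<ge> 1"
  shows "cumulant (unif N) (Z N) n =
    (- 1) ^ n * bernoulli_number n / real n * (\<Sum>k=1..N. (2 ^ n) ^ k - 1)"
proof -
  define L where "L = Abs_fps (\<lambda>n. if n = 0 then 0 else
    (- 1) ^ n * bernoulli_number n / (real n * fact n))"
  have "(\<lambda>u. \<Sum>k=1..N. ln (expm1_ratio (2 ^ k * u)) - ln (expm1_ratio u)) has_fps_expansion
      (\<Sum>k=1..N. Abs_fps (\<lambda>n. (2 ^ k) ^ n * fps_nth L n) - L)"
    unfolding L_def
    by (intro fps_expansion_intros has_fps_expansion_scale ln_expm1_ratio_has_fps_expansion)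
  also have "(\<lambda>u. \<Sum>k=1..N. ln (expm1_ratio (2 ^ k * u)) - ln (expm1_ratio u)) =
      (\<lambda>u. ln (mgf (unif N) (Z N) u))"
    by (simp add: fun_eq_iff mgf_Z ln_prod ln_div less_imp_neq[OF expm1_ratio_pos, symmetric])
  finally have "cgf_series (unif N) (Z N) =
      (\<Sum>k=1..N. Abs_fps (\<lambda>n. (2 ^ k) ^ n * fps_nth L n) - L)"
    by (intro cgf_seriesI) auto
  then have "fps_nth (cgf_series (unif N) (Z N)) n = (\<Sum>k=1..N. (2 ^ k) ^ n * fps_nth L n - fps_nth L n)"
    by (simp add: fps_sum_nth)
  also have "\<dots> = (\<Sum>k=1..N. (2 ^ n) ^ k - 1) * fps_nth L n"
    by (simp add: sum_distrib_right left_diff_distrib flip: power_mult) (simp add: mult.commute)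
  finally show ?thesis
    using assms by (simp add: cumulant_def L_def)
qed

lemma sum_powers_minus_1:
  fixes x :: real
  assumes "x \<noteq> 1"
  shows "(\<Sum>k=1..N. x ^ k - 1) = (x * (x ^ N - real N - 1) + real N) / (x - 1)"
  using assms by (induction N) (simp_all add: field_simps)

lemma mu_eq: "mu N = (\<Sum>k=1..N. (2 ^ k - 1) / 2)"
proof -
  have "mu N = cumulant (unif N) (Z N) 1"
    unfolding mu_def unif_def by (rule cumulant_1[OF finite_set_pmf_of_set_Omega, symmetric])
  then show ?thesis
    by (simp add: cumulant_Z bernoulli_number_0_1_2[simplified] sum_divide_distrib)
qed

lemma sigma_squared: "(sigma N)\<^sup>2 = (4 ^ N - 3 / 4 * real N - 1) / 9"
proof -
  have "(sigma N)\<^sup>2 = (\<integral>\<omega>. (Z N \<omega> - mu N)\<^sup>2 \<partial>unif N)"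
    by (simp add: sigma_def)
  also have "\<dots> = cumulant (unif N) (Z N) 2"
    unfolding mu_def unif_def by (rule cumulant_2[OF finite_set_pmf_of_set_Omega, symmetric])
  also have "\<dots> = (\<Sum>k=1..N. 4 ^ k - 1) / 12"
    by (simp add: cumulant_Z bernoulli_number_0_1_2)
  also have "\<dots> = (4 * (4 ^ N - real N - 1) + real N) / 3 / 12"
    by (subst sum_powers_minus_1) simp_all
  finally show ?thesis
    by (simp add: field_simps)
qed

section \<open>The standardised sum\<close>

lemma mgf_Zhat:
  "mgf (unif N) (Zhat N) t = (\<Prod>k=1..N. 1 / 2 ^ k * sinh_ratio k (t / (2 * sigma N)))"
proof -
  define u where "u = t / sigma N"
  have "mgf (unif N) (Zhat N) t = exp (- (mu N * u)) * mgf (unif N) (Z N) u"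
    unfolding Zhat_def [abs_def] mgf_affine by (simp add: u_def)
  also have "mgf (unif N) (Z N) u =
      (\<Prod>k=1..N. exp ((2 ^ k - 1) * u / 2)) * (\<Prod>k=1..N. 1 / 2 ^ k * sinh_ratio k (u / 2))"
    unfolding mgf_Z expm1_ratio_quotient_eq_sinh_ratio by (rule prod.distrib)
  also have "(\<Prod>k=1..N. exp ((2 ^ k - 1) * u / 2)) = exp (mu N * u)"
    by (simp add: mu_eq sum_distrib_right exp_sum)
  finally show ?thesis
    by (simp add: u_def exp_minus mult.commute)
qed

text \<open>Iterating \<open>sinh (2 x) = 2 sinh x cosh x\<close> telescopes the ratio; each step contributes a factor 2,
  and the prefactor \<open>1 / 2\<^sup>k\<close> cancels them.\<close>

lemma sinh_ratio_eq_prod_cosh: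
  "1 / 2 ^ k * sinh_ratio k s = (\<Prod>l=1..k. cosh (2 ^ (k - l) * s))"
proof -
  have "1 / 2 ^ k * sinh_ratio k s = (\<Prod>j<k. cosh (2 ^ j * s))"
  proof (induction k)
    case (Suc k)
    have "sinh_ratio (Suc k) s = 2 * cosh (2 ^ k * s) * sinh_ratio k s"
      using sinh_double[of "2 ^ k * s"] by (simp add: sinh_ratio_def mult_ac)
    with Suc show ?case by (simp add: field_simps)
  qed (simp add: sinh_ratio_def)
  also have "\<dots> = (\<Prod>l=1..k. cosh (2 ^ (k - l) * s))"
    by (rule prod.reindex_bij_witness[of _ "\<lambda>l. k - l" "\<lambda>j. k - j"]) auto
  finally show ?thesis .
qed

lemma prod_cosh:
  "(\<Prod>k=1..N. 1 / 2 ^ k * sinh_ratio k s) =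
    (\<Prod>(l, k)\<in>{(l, k). 1 \<le> l \<and> l \<le> k \<and> k \<le> N}. cosh (2 ^ (k - l) * s))"
proof -
  have "(\<Prod>k=1..N. 1 / 2 ^ k * sinh_ratio k s) = (\<Prod>(k, l)\<in>Sigma {1..N} (\<lambda>k. {1..k}). cosh (2 ^ (k - l) * s))"
    unfolding sinh_ratio_eq_prod_cosh by (subst prod.Sigma) auto
  also have "\<dots> = (\<Prod>(l, k)\<in>{(l, k). 1 \<le> l \<and> l \<le> k \<and> k \<le> N}. cosh (2 ^ (k - l) * s))"
    by (rule prod.reindex_bij_witness[of _ "\<lambda>(l, k). (k, l)" "\<lambda>(k, l). (l, k)"]) auto
  finally show ?thesis .
qed

lemma sinh_ratio_pos: "sinh_ratio k s > 0"
proof -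
  have "1 / 2 ^ k * sinh_ratio k s > 0"
    unfolding sinh_ratio_eq_prod_cosh by (intro prod_pos) auto
  then show ?thesis by (simp add: zero_less_divide_iff)
qed

text \<open>The sign \<open>(-1)\<^sup>n\<close> of \<open>cumulant_Z\<close> disappears here: it matters for \<open>n = 1\<close> only, where
  centring makes the cumulant 0.\<close>

lemma cumulant_Zhat:
  assumes "n \<ge> 1"
  shows "cumulant (unif N) (Zhat N) n = (if n = 1 then 0 else
    bernoulli_number n / real n * (\<Sum>k=1..N. (2 ^ n) ^ k - 1) / sigma N ^ n)"
proof -
  have "cumulant (unif N) (Zhat N) n =
    (cumulant (unif N) (Z N) n - (if n = 1 then mu N else 0)) / sigma N ^ n"
    unfolding Zhat_def [abs_def] unif_def by (rule cumulant_affine[OF finite_set_pmf_of_set_Omega])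
  moreover have "cumulant (unif N) (Z N) 1 = mu N"
    unfolding mu_def unif_def by (rule cumulant_1[OF finite_set_pmf_of_set_Omega])
  ultimately show ?thesis
    using assms by (cases "n = 1") (simp_all add: cumulant_Z bernoulli_number_reflect)
qed

theorem proposition3p1:
  fixes N :: nat
  assumes "N \<ge> 1"
  shows "(\<forall>t. mgf (unif N) (Zhat N) t
              = (\<Prod>k=1..N. 1 / 2 ^ k * sinh_ratio k (t / (2 * sigma N))) \<and>
            (\<Prod>k=1..N. 1 / 2 ^ k * sinh_ratio k (t / (2 * sigma N)))
              = (\<Prod>(l, k)\<in>{(l, k). 1 \<le> l \<and> l \<le> k \<and> k \<le> N}.
                   cosh (2 ^ (k - l) * (t / (2 * sigma N))))) \<and>
         (\<forall>t. ln (mgf (unif N) (Zhat N) t)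
              = (\<Sum>k=1..N. ln (1 / 2 ^ k * sinh_ratio k (t / (2 * sigma N))))) \<and>
         (\<forall>n\<ge>1. cumulant (unif N) (Zhat N) (2 * n - 1) = 0 \<and>
            cumulant (unif N) (Zhat N) (2 * n)
              = 9 ^ n / (4 ^ n - 1)
                * ((4 ^ n * (4 ^ (n * N) - real N - 1) + real N)
                   / (4 ^ N - 3 / 4 * real N - 1) ^ n)
                * (bernoulli_number (2 * n) / (2 * real n)))"
proof (intro conjI allI impI)
  fix t
  show "mgf (unif N) (Zhat N) t = (\<Prod>k=1..N. 1 / 2 ^ k * sinh_ratio k (t / (2 * sigma N)))"
    by (rule mgf_Zhat)
  show "(\<Prod>k=1..N. 1 / 2 ^ k * sinh_ratio k (t / (2 * sigma N)))
      = (\<Prod>(l, k)\<in>{(l, k). 1 \<le> l \<and> l \<le> k \<and> k \<le> N}. cosh (2 ^ (k - l) * (t / (2 * sigma N))))"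
    by (rule prod_cosh)
  show "ln (mgf (unif N) (Zhat N) t)
      = (\<Sum>k=1..N. ln (1 / 2 ^ k * sinh_ratio k (t / (2 * sigma N))))"
    unfolding mgf_Zhat by (rule ln_prod) (simp_all add: less_imp_neq[OF sinh_ratio_pos, symmetric])
next
  fix n :: nat
  assume n: "n \<ge> 1"
  show "cumulant (unif N) (Zhat N) (2 * n - 1) = 0"
    using n by (auto simp: cumulant_Zhat bernoulli_number_odd)
  have "(1 :: real) < 4 ^ n"
    using n by (intro one_less_power) auto
  then have "(4 :: real) ^ n \<noteq> 1"
    by simp
  then have "(\<Sum>k=1..N. ((2 :: real) ^ (2 * n)) ^ k - 1) =
      (4 ^ n * (4 ^ (n * N) - real N - 1) + real N) / (4 ^ n - 1)"
    by (subst sum_powers_minus_1) (simp_all add: power_mult)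
  moreover have "sigma N ^ (2 * n) = (4 ^ N - 3 / 4 * real N - 1) ^ n / 9 ^ n"
    by (simp add: power_mult sigma_squared power_divide)
  moreover have "cumulant (unif N) (Zhat N) (2 * n) =
      bernoulli_number (2 * n) / (2 * real n) * (\<Sum>k=1..N. (2 ^ (2 * n)) ^ k - 1) / sigma N ^ (2 * n)"
    using n by (subst cumulant_Zhat) auto
  ultimately show "cumulant (unif N) (Zhat N) (2 * n)
      = 9 ^ n / (4 ^ n - 1)
        * ((4 ^ n * (4 ^ (n * N) - real N - 1) + real N) / (4 ^ N - 3 / 4 * real N - 1) ^ n)
        * (bernoulli_number (2 * n) / (2 * real n))"
    by (simp only:) (simp add: mult_ac)
qed

end
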